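(* Let $d, N$ be integers with $d \geq 2$ and $N \geq d$, let $0 < c_1 < c_2$ be real numbers, and let $\sigma \geq 0$ satisfy $\sigma < c_1/\sqrt{d}$. Then there exists an extremal vector system $(v_i)_{i=1}^N \subset \mathbb{R}^d$, i.e. one which attains the maximum $$\max_{\substack{v_1, \ldots, v_N \in \mathbb{R}^d \\ c_1 \leq |v_i|^2 \leq c_2 \ \forall i}} \ \min_{1 \leq k \leq N} \log\left(1 + \frac{|v_k|^2}{\sigma^2 + \sum_{l \neq k} \langle v_k, v_l \rangle^2}\right),$$ containing at most $$d\, \frac{c_1^2 - \sigma^2}{c_1^2 - d\sigma^2}$$ vectors (counted by index $i$) of norm strictly larger than $\sqrt{c_1}$.
   Context: $|\cdot|$ and $\langle \cdot,\cdot\rangle$ are the Euclidean norm and inner product on $\mathbb{R}^d$. Sums $\sum_{l \neq k}$ run over $l \in \{1,\ldots,N\}\setminus\{k\}$. Convention: a positive number divided by $0$ equals $+\infty$, and $\log(+\infty)=+\infty$. The logarithm is taken to any fixed base greater than $1$. Vector systems are indexed families (repetitions are allowed). *)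

theory Defs
  imports "HOL-Analysis.Analysis"
begin

text \<open>
  The logarithm to base \<open>b\<close> on extended reals, with \<open>log \<infinity> = \<infinity>\<close>. Below it is only applied to
  arguments \<open>\<ge> 1\<close>; the value \<open>-\<infinity>\<close> on nonpositive arguments is a dummy.
\<close>

definition elog :: "real \<Rightarrow> ereal \<Rightarrow> ereal" where
  "elog b x =
     (if x = \<infinity> then \<infinity> else if x \<le> 0 then -\<infinity> else ereal (log b (real_of_ereal x)))"

text \<open>
  A system \<open>v\<^sub>1, \<dots>, v\<^sub>N\<close> is a function \<open>v\<close> on \<open>nat\<close>; only its values on \<open>{1..N}\<close> matter.
  The quotient is taken in \<open>ereal\<close>, where a positive number divided by \<open>0\<close> is \<open>\<infinity>\<close>
  (whereas it would be \<open>0\<close> in \<open>real\<close>).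
\<close>

definition rate :: "real \<Rightarrow> real \<Rightarrow> nat \<Rightarrow> (nat \<Rightarrow> real ^ 'd) \<Rightarrow> nat \<Rightarrow> ereal" where
  "rate b \<sigma> N v k =
     elog b (1 + ereal ((norm (v k))\<^sup>2) / ereal (\<sigma>\<^sup>2 + (\<Sum>l\<in>{1..N} - {k}. (v k \<bullet> v l)\<^sup>2)))"

definition min_rate :: "real \<Rightarrow> real \<Rightarrow> nat \<Rightarrow> (nat \<Rightarrow> real ^ 'd) \<Rightarrow> ereal" where
  "min_rate b \<sigma> N v = Min (rate b \<sigma> N v ` {1..N})"

definition admissible :: "real \<Rightarrow> real \<Rightarrow> nat \<Rightarrow> (nat \<Rightarrow> real ^ 'd) \<Rightarrow> bool" where
  "admissible c\<^sub>1 c\<^sub>2 N v \<longleftrightarrow> (\<forall>i\<in>{1..N}. c\<^sub>1 \<le> (norm (v i))\<^sup>2 \<and> (norm (v i))\<^sup>2 \<le> c\<^sub>2)"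

definition extremal :: "real \<Rightarrow> real \<Rightarrow> real \<Rightarrow> real \<Rightarrow> nat \<Rightarrow> (nat \<Rightarrow> real ^ 'd) \<Rightarrow> bool" where
  "extremal b \<sigma> c\<^sub>1 c\<^sub>2 N v \<longleftrightarrow> is_arg_max (min_rate b \<sigma> N) (admissible c\<^sub>1 c\<^sub>2 N) v"

end

theory Submission
  imports Defs
begin

text \<open>
  Among all extremal systems take one with the least \<open>\<Sum>\<^sub>k |v\<^sub>k|\<^sup>2\<close>. If two of its vectors
  \<open>v\<^sub>i, v\<^sub>j\<close> have norm greater than \<open>sqrt c\<^sub>1\<close>, then \<open>\<langle>v\<^sub>i, v\<^sub>j\<rangle>\<^sup>2 \<le> \<sigma>\<^sup>2\<close>: otherwise
  scaling both by the same factor slightly below \<open>1\<close> decreases no rate, because the loss of signal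
  relative to the noise at \<open>i\<close> and \<open>j\<close> is made up for by their weaker mutual interference. So the
  directions of the vectors longer than \<open>sqrt c\<^sub>1\<close> have pairwise squared inner products at most
  \<open>x = \<sigma>\<^sup>2 / c\<^sub>1\<^sup>2\<close>, and the Welch bound \<open>m\<^sup>2 / d \<le> m + m (m - 1) x\<close> limits their number \<open>m\<close>.
\<close>

section \<open>Rates in terms of the inverse signal-to-noise ratio\<close>

text \<open>Reciprocal of the quotient inside \<open>rate\<close>. Its denominator does not vanish
  on admissible systems when \<open>0 < c\<^sub>1\<close>, so it stays a finite, continuous real
  function even where the rate is \<infinity>. Maximising \<open>min_rate\<close> becomes minimising
  the maximum of \<open>inv_sinr\<close>.\<close>

definition inv_sinr :: "real \<Rightarrow> nat \<Rightarrow> (nat \<Rightarrow> real ^ 'd) \<Rightarrow> nat \<Rightarrow> real" where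
  "inv_sinr \<sigma> N v k = (\<sigma>\<^sup>2 + (\<Sum>l\<in>{1..N} - {k}. (v k \<bullet> v l)\<^sup>2)) / (norm (v k))\<^sup>2"

text \<open>The rate is an increasing function of the reciprocal of \<open>inv_sinr\<close>. Systems
  and indices may both differ, since the two minima to be compared can sit at different
  indices.\<close>

lemma rate_antimono_inv_sinr:
  fixes v w :: "nat \<Rightarrow> real ^ 'd"
  assumes "1 < b" and v: "v k \<noteq> 0" and w: "w j \<noteq> 0"
    and le: "inv_sinr \<sigma> N v k \<le> inv_sinr \<sigma> N w j"
  shows "rate b \<sigma> N w j \<le> rate b \<sigma> N v k"
proof -
  define A where "A = (norm (v k))\<^sup>2"
  define B where "B = (norm (w j))\<^sup>2"
  define D where "D = \<sigma>\<^sup>2 + (\<Sum>l\<in>{1..N} - {k}. (v k \<bullet> v l)\<^sup>2)"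
  define E where "E = \<sigma>\<^sup>2 + (\<Sum>l\<in>{1..N} - {j}. (w j \<bullet> w l)\<^sup>2)"
  have A: "A > 0" and B: "B > 0"
    using v w by (auto simp: A_def B_def)
  have D: "D \<ge> 0" and E: "E \<ge> 0"
    by (auto simp: D_def E_def intro!: add_nonneg_nonneg sum_nonneg)
  have DE: "D / A \<le> E / B"
    using le by (simp add: inv_sinr_def A_def B_def D_def E_def)
  have rv: "rate b \<sigma> N v k = elog b (1 + ereal A / ereal D)"
    by (simp add: rate_def A_def D_def)
  have rw: "rate b \<sigma> N w j = elog b (1 + ereal B / ereal E)"
    by (simp add: rate_def B_def E_def)
  show ?thesis
  \<comment> \<open>Noise \<open>0\<close> makes the rate \<infinity> by the \<open>ereal\<close>
    convention. Otherwise \<open>E\<close> is positive too, and both quotients are real.\<close>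
  proof (cases "D = 0")
    case True
    then have "rate b \<sigma> N v k = \<infinity>"
      using A by (simp add: rv elog_def)
    then show ?thesis by simp
  next
    case False
    then have D0: "D > 0" using D by simp
    then have "D / A > 0" using A by simp
    then have "E / B > 0" using DE by linarith
    then have E0: "E > 0" using B by (simp add: zero_less_divide_iff)
    have *: "B / E \<le> A / D"
      using DE A B D0 E0 by (simp add: field_simps)
    have "0 \<le> B / E" using B E0 by simp
    with * show ?thesis
      using D0 E0 \<open>1 < b\<close> unfolding rv rw
      by (simp add: elog_def one_ereal_def)
  qed
qed

text \<open>An index \<open>j\<close> where \<open>w\<close> has its largest \<open>inv_sinr\<close>
  has a rate no larger than any rate of \<open>v\<close>.\<close>

lemma min_rate_mono:
  fixes v w :: "nat \<Rightarrow> real ^ 'd"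
  assumes "1 < b" and "1 \<le> N"
    and v: "\<And>k. k \<in> {1..N} \<Longrightarrow> v k \<noteq> 0" and w: "\<And>k. k \<in> {1..N} \<Longrightarrow> w k \<noteq> 0"
    and le: "Max (inv_sinr \<sigma> N v ` {1..N}) \<le> Max (inv_sinr \<sigma> N w ` {1..N})"
  shows "min_rate b \<sigma> N w \<le> min_rate b \<sigma> N v"
proof -
  have ne: "{1..N} \<noteq> {}" using \<open>1 \<le> N\<close> by simp
  have "Max (inv_sinr \<sigma> N w ` {1..N}) \<in> inv_sinr \<sigma> N w ` {1..N}"
    using ne by (intro Max_in) auto
  then obtain j where j: "j \<in> {1..N}" "Max (inv_sinr \<sigma> N w ` {1..N}) = inv_sinr \<sigma> N w j"
    by auto
  have "min_rate b \<sigma> N w \<le> rate b \<sigma> N v k" if k: "k \<in> {1..N}" for k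
  proof -
    have "inv_sinr \<sigma> N v k \<le> Max (inv_sinr \<sigma> N v ` {1..N})"
      using k by (intro Max_ge) auto
    then have "inv_sinr \<sigma> N v k \<le> inv_sinr \<sigma> N w j"
      using le j(2) by linarith
    then have "rate b \<sigma> N w j \<le> rate b \<sigma> N v k"
      using rate_antimono_inv_sinr[of b v k w j, OF \<open>1 < b\<close> v[OF k] w[OF j(1)]] by blast
    moreover have "min_rate b \<sigma> N w \<le> rate b \<sigma> N w j"
      unfolding min_rate_def using j(1) by (intro Min_le) auto
    ultimately show ?thesis by (rule order_trans[rotated])
  qed
  then show ?thesis
    unfolding min_rate_def[of b \<sigma> N v] using ne by (intro Min.boundedI) auto
qed

section \<open>Compactness and the choice of an extremal system\<close>

lemma continuous_on_Max:
  fixes f :: "'i \<Rightarrow> 'a::topological_space \<Rightarrow> 'b::linorder_topology"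
  assumes "finite I" and "I \<noteq> {}" and "\<And>i. i \<in> I \<Longrightarrow> continuous_on S (f i)"
  shows "continuous_on S (\<lambda>x. Max ((\<lambda>i. f i x) ` I))"
  using assms
proof (induction rule: finite_ne_induct)
  case (insert i I)
  have "Max ((\<lambda>i. f i x) ` insert i I) = max (f i x) (Max ((\<lambda>i. f i x) ` I))" for x
    using insert.hyps by simp
  then show ?case
    using insert by (simp add: continuous_on_max)
qed simp

text \<open>The minimisers of \<open>f\<close> form a closed, hence compact, subset of
  \<open>K\<close>, on which \<open>g\<close> attains its minimum.\<close>

lemma compact_lexicographic_min:
  fixes f g :: "'a::t2_space \<Rightarrow> real"
  assumes K: "compact K" "K \<noteq> {}" and f: "continuous_on K f" and g: "continuous_on K g"
  obtains x where "x \<in> K" and "\<And>y. y \<in> K \<Longrightarrow> f x \<le> f y"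
    and "\<And>y. y \<in> K \<Longrightarrow> f y \<le> f x \<Longrightarrow> g x \<le> g y"
proof -
  obtain x0 where x0: "x0 \<in> K" "\<And>y. y \<in> K \<Longrightarrow> f x0 \<le> f y"
    using continuous_attains_inf[OF K f] by blast
  define L where "L = K \<inter> f -` {..f x0}"
  have "closedin (top_of_set K) L"
    unfolding L_def using f by (rule continuous_closedin_preimage) simp
  then have "compact L"
    using K(1) closedin_compact by blast
  moreover have "x0 \<in> L" using x0 by (simp add: L_def)
  moreover have "continuous_on L g"
    using g by (rule continuous_on_subset) (simp add: L_def)
  ultimately obtain x where x: "x \<in> L" "\<And>y. y \<in> L \<Longrightarrow> g x \<le> g y"
    using continuous_attains_inf[of L g] by blast
  show thesis
  proof
    show "x \<in> K" using x by (simp add: L_def)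
    show "f x \<le> f y" if "y \<in> K" for y
      using x(1) x0(2)[OF that] by (simp add: L_def)
    show "g x \<le> g y" if "y \<in> K" "f y \<le> f x" for y
      using x that by (simp add: L_def)
  qed
qed

lemma continuous_on_inv_sinr:
  fixes K :: "(nat \<Rightarrow> real ^ 'd) set"
  assumes "\<And>v. v \<in> K \<Longrightarrow> v k \<noteq> 0"
  shows "continuous_on K (\<lambda>v. inv_sinr \<sigma> N v k)"
proof -
  have [continuous_intros]: "continuous_on K (\<lambda>v. v l)" for l
    by (rule continuous_on_subset[OF continuous_on_product_coordinates]) simp
  show ?thesis
    unfolding inv_sinr_def using assms by (intro continuous_intros) auto
qed

lemma inv_sinr_cong:
  assumes "\<And>i. i \<in> {1..N} \<Longrightarrow> v i = w i" and "k \<in> {1..N}"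
  shows "inv_sinr \<sigma> N v k = inv_sinr \<sigma> N w k"
  using assms by (simp add: inv_sinr_def)

text \<open>Minimise first the largest \<open>inv_sinr\<close>, which gives extremality, then the
  sum of squared norms. A system \<open>w\<close> with no larger \<open>inv_sinr\<close> at any
  index is again a first-stage minimiser, so its sum cannot be smaller.\<close>

lemma extremal_lexicographic:
  fixes b \<sigma> c\<^sub>1 c\<^sub>2 :: real
  assumes "1 < b" and "1 \<le> N" and "0 < c\<^sub>1" and "c\<^sub>1 < c\<^sub>2"
  obtains v :: "nat \<Rightarrow> real ^ 'd" where
    "admissible c\<^sub>1 c\<^sub>2 N v" and "extremal b \<sigma> c\<^sub>1 c\<^sub>2 N v"
    and "\<And>w :: nat \<Rightarrow> real ^ 'd. admissible c\<^sub>1 c\<^sub>2 N w \<Longrightarrow>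
           (\<And>k. k \<in> {1..N} \<Longrightarrow> inv_sinr \<sigma> N w k \<le> inv_sinr \<sigma> N v k) \<Longrightarrow>
           (\<Sum>k\<in>{1..N}. (norm (v k))\<^sup>2) \<le> (\<Sum>k\<in>{1..N}. (norm (w k))\<^sup>2)"
proof -
  define A :: "(real ^ 'd) set" where "A = {x. c\<^sub>1 \<le> (norm x)\<^sup>2 \<and> (norm x)\<^sup>2 \<le> c\<^sub>2}"
  \<comment> \<open>Admissibility leaves the values outside \<open>{1..N}\<close> free, which
    destroys compactness. Fixing them to \<open>0\<close> gives a product of compact sets, compact
    by Tychonoff.\<close>
  define K :: "(nat \<Rightarrow> real ^ 'd) set"
    where "K = PiE UNIV (\<lambda>i. if i \<in> {1..N} then A else {0})"
  define M where "M = (\<lambda>v :: nat \<Rightarrow> real ^ 'd. Max ((\<lambda>k. inv_sinr \<sigma> N v k) ` {1..N}))"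
  define S where "S = (\<lambda>v :: nat \<Rightarrow> real ^ 'd. \<Sum>k\<in>{1..N}. (norm (v k))\<^sup>2)"
  have nz: "v k \<noteq> 0" if "admissible c\<^sub>1 c\<^sub>2 N v" "k \<in> {1..N}" for v :: "nat \<Rightarrow> real ^ 'd" and k
    using that \<open>0 < c\<^sub>1\<close> by (force simp: admissible_def)
  have K_adm: "admissible c\<^sub>1 c\<^sub>2 N v" if "v \<in> K" for v
  proof -
    have "v i \<in> A" if "i \<in> {1..N}" for i
      using PiE_mem[OF \<open>v \<in> K\<close>[unfolded K_def] UNIV_I, of i] that by simp
    then show ?thesis by (auto simp: admissible_def A_def)
  qed
  have "closed A"
    unfolding A_def by (intro closed_Collect_conj closed_Collect_le continuous_intros)
  moreover have "bounded A"
  proof (rule boundedI)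
    fix x assume "x \<in> A"
    then show "norm x \<le> sqrt c\<^sub>2"
      by (simp add: A_def real_le_rsqrt)
  qed
  ultimately have "compact A"
    by (simp add: compact_eq_bounded_closed)
  then have "compactin (product_topology (\<lambda>_. euclidean) UNIV) K"
    unfolding K_def compactin_PiE by simp
  then have "compact K"
    by (simp add: euclidean_product_topology)
  \<comment> \<open>A point of \<open>A\<close>, for nonemptiness; \<open>undefined\<close> just
    picks some coordinate.\<close>
  have "sqrt c\<^sub>1 *\<^sub>R axis undefined 1 \<in> A"
    using assms by (simp add: A_def)
  then have "(\<lambda>i. if i \<in> {1..N} then sqrt c\<^sub>1 *\<^sub>R axis undefined 1 else 0) \<in> K"
    unfolding K_def by auto
  then have "K \<noteq> {}" by blast
  have "continuous_on K M"
    unfolding M_def using \<open>1 \<le> N\<close> nz K_adm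
    by (intro continuous_on_Max continuous_on_inv_sinr) auto
  moreover have "continuous_on K S"
    unfolding S_def
    by (intro continuous_intros continuous_on_subset[OF continuous_on_product_coordinates]) simp
  ultimately obtain v where v: "v \<in> K" "\<And>w. w \<in> K \<Longrightarrow> M v \<le> M w"
    "\<And>w. w \<in> K \<Longrightarrow> M w \<le> M v \<Longrightarrow> S v \<le> S w"
    using compact_lexicographic_min[OF \<open>compact K\<close> \<open>K \<noteq> {}\<close>] by blast
  \<comment> \<open>Zeroing the values outside \<open>{1..N}\<close> carries minimality on
    \<open>K\<close> over to all admissible systems.\<close>
  have cut: "\<exists>w'\<in>K. M w' = M w \<and> S w' = S w" if w: "admissible c\<^sub>1 c\<^sub>2 N w"
    for w :: "nat \<Rightarrow> real ^ 'd"
  proof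
    let ?w = "\<lambda>i. if i \<in> {1..N} then w i else 0"
    show "?w \<in> K"
      using w unfolding K_def by (auto simp: admissible_def A_def)
    have "inv_sinr \<sigma> N ?w k = inv_sinr \<sigma> N w k" if "k \<in> {1..N}" for k
      using that by (intro inv_sinr_cong) auto
    then have "inv_sinr \<sigma> N ?w ` {1..N} = inv_sinr \<sigma> N w ` {1..N}"
      by (rule image_cong[OF refl])
    then show "M ?w = M w \<and> S ?w = S w"
      by (simp add: M_def S_def)
  qed
  have min: "M v \<le> M w" if "admissible c\<^sub>1 c\<^sub>2 N w" for w :: "nat \<Rightarrow> real ^ 'd"
    using cut[OF that] v(2) by metis
  show thesis
  proof
    show adm: "admissible c\<^sub>1 c\<^sub>2 N v" by (rule K_adm[OF v(1)])
    have "min_rate b \<sigma> N w \<le> min_rate b \<sigma> N v" if "admissible c\<^sub>1 c\<^sub>2 N w"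
      for w :: "nat \<Rightarrow> real ^ 'd"
      using min[OF that] nz adm that assms(1,2) by (intro min_rate_mono) (auto simp: M_def)
    then show "extremal b \<sigma> c\<^sub>1 c\<^sub>2 N v"
      using adm by (auto simp: extremal_def is_arg_max_def not_less)
    fix w :: "nat \<Rightarrow> real ^ 'd"
    assume w: "admissible c\<^sub>1 c\<^sub>2 N w"
      and le: "\<And>k. k \<in> {1..N} \<Longrightarrow> inv_sinr \<sigma> N w k \<le> inv_sinr \<sigma> N v k"
    have "M w \<le> M v"
      unfolding M_def
    proof (rule Max.boundedI)
      fix a assume "a \<in> inv_sinr \<sigma> N w ` {1..N}"
      then obtain k where k: "k \<in> {1..N}" "a = inv_sinr \<sigma> N w k" by blast
      then have "a \<le> inv_sinr \<sigma> N v k" using le by simp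
      also have "\<dots> \<le> Max (inv_sinr \<sigma> N v ` {1..N})" using k by (intro Max_ge) auto
      finally show "a \<le> Max (inv_sinr \<sigma> N v ` {1..N})" .
    qed (use \<open>1 \<le> N\<close> in auto)
    then show "(\<Sum>k\<in>{1..N}. (norm (v k))\<^sup>2) \<le> (\<Sum>k\<in>{1..N}. (norm (w k))\<^sup>2)"
      using cut[OF w] v(3) unfolding S_def by metis
  qed
qed

section \<open>Effect of shrinking vectors on the inverse ratio\<close>

text \<open>The signal at \<open>k\<close> is unchanged, while each interference term can only
  decrease.\<close>

lemma inv_sinr_scale_others:
  fixes v :: "nat \<Rightarrow> real ^ 'd"
  assumes "a k = 1" and "\<And>l. l \<in> {1..N} \<Longrightarrow> \<bar>a l\<bar> \<le> 1"
  shows "inv_sinr \<sigma> N (\<lambda>l. a l *\<^sub>R v l) k \<le> inv_sinr \<sigma> N v k"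
proof -
  have "(a l * (v k \<bullet> v l))\<^sup>2 \<le> (v k \<bullet> v l)\<^sup>2" if "l \<in> {1..N}" for l
  proof -
    have "(a l)\<^sup>2 \<le> 1" using assms(2)[OF that] by (simp add: abs_square_le_1)
    then have "(a l)\<^sup>2 * (v k \<bullet> v l)\<^sup>2 \<le> 1 * (v k \<bullet> v l)\<^sup>2"
      by (intro mult_right_mono) auto
    then show ?thesis by (simp add: power_mult_distrib)
  qed
  then show ?thesis
    using assms(1) unfolding inv_sinr_def
    by (auto intro!: divide_right_mono add_mono sum_mono)
qed

text \<open>With \<open>t = s\<^sup>2\<close>, the signal at \<open>i\<close> and the interference
  from third vectors scale by \<open>t\<close>, the mutual interference by \<open>t * t\<close>, and
  the noise \<open>\<sigma>\<^sup>2\<close> not at all. The assumption on \<open>\<sigma>\<close>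
  says that the gain covers the loss.\<close>

lemma inv_sinr_scale_pair:
  fixes v :: "nat \<Rightarrow> real ^ 'd"
  assumes "i \<in> {1..N}" "j \<in> {1..N}" "i \<noteq> j" and "0 < s" "s < 1"
    and \<sigma>: "\<sigma>\<^sup>2 \<le> s\<^sup>2 * (v i \<bullet> v j)\<^sup>2" and a: "a i = s" "a j = s"
    and one: "\<And>l. l \<noteq> i \<Longrightarrow> l \<noteq> j \<Longrightarrow> a l = 1"
  shows "inv_sinr \<sigma> N (\<lambda>l. a l *\<^sub>R v l) i \<le> inv_sinr \<sigma> N v i"
proof -
  define P where "P = (v i \<bullet> v j)\<^sup>2"
  define R where "R = (\<Sum>l\<in>{1..N} - {i} - {j}. (v i \<bullet> v l)\<^sup>2)"
  define t where "t = s\<^sup>2"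
  have t: "0 < t" "t < 1"
    using \<open>0 < s\<close> \<open>s < 1\<close> by (auto simp: t_def abs_square_less_1)
  have "(\<Sum>l\<in>{1..N} - {i}. (v i \<bullet> v l)\<^sup>2) = P + R"
    unfolding P_def R_def using assms by (intro sum.remove) auto
  then have 1: "inv_sinr \<sigma> N v i = (\<sigma>\<^sup>2 + P + R) / (norm (v i))\<^sup>2"
    by (simp add: inv_sinr_def)
  have "(\<Sum>l\<in>{1..N} - {i}. ((a i *\<^sub>R v i) \<bullet> (a l *\<^sub>R v l))\<^sup>2) =
      ((a i *\<^sub>R v i) \<bullet> (a j *\<^sub>R v j))\<^sup>2 +
      (\<Sum>l\<in>{1..N} - {i} - {j}. ((a i *\<^sub>R v i) \<bullet> (a l *\<^sub>R v l))\<^sup>2)"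
    using assms by (intro sum.remove) auto
  also have "\<dots> = t * t * P + (\<Sum>l\<in>{1..N} - {i} - {j}. t * (v i \<bullet> v l)\<^sup>2)"
    using one a by (simp add: P_def t_def power_mult_distrib)
  also have "\<dots> = t * t * P + t * R"
    by (simp add: R_def sum_distrib_left)
  finally have 2: "inv_sinr \<sigma> N (\<lambda>l. a l *\<^sub>R v l) i =
      (\<sigma>\<^sup>2 + t * t * P + t * R) / (t * (norm (v i))\<^sup>2)"
    using a \<open>0 < s\<close> by (simp add: inv_sinr_def t_def power_mult_distrib)
  \<comment> \<open>This product is the right side minus the left side of the next
    inequality.\<close>
  have "0 \<le> (1 - t) * (t * P - \<sigma>\<^sup>2)"
    using t \<sigma> by (simp add: P_def t_def)
  then have "\<sigma>\<^sup>2 + t * t * P + t * R \<le> t * (\<sigma>\<^sup>2 + P + R)"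
    by (simp add: algebra_simps)
  then have "(\<sigma>\<^sup>2 + t * t * P + t * R) / (t * (norm (v i))\<^sup>2)
      \<le> t * (\<sigma>\<^sup>2 + P + R) / (t * (norm (v i))\<^sup>2)"
    using t by (intro divide_right_mono) auto
  then show ?thesis
    using t unfolding 1 2 by simp
qed

section \<open>The Welch bound and almost orthogonal unit vectors\<close>

text \<open>\<open>S\<close> is the matrix of the frame operator, the sum of the \<open>u k\<close>
  times their transposes. Its trace is the sum of squared norms, and its squared Frobenius norm is
  the double sum on the right. Cauchy-Schwarz on the diagonal bounds the squared trace by the
  dimension times the squared Frobenius norm.\<close>

lemma Welch_bound:
  fixes u :: "'i \<Rightarrow> real ^ 'd"
  shows "(\<Sum>k\<in>T. (norm (u k))\<^sup>2)\<^sup>2 \<le> real CARD('d) * (\<Sum>j\<in>T. \<Sum>k\<in>T. (u j \<bullet> u k)\<^sup>2)"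
proof -
  define S where "S = (\<lambda>a c. \<Sum>k\<in>T. u k $ a * u k $ c)"
  have "(\<Sum>k\<in>T. (norm (u k))\<^sup>2) = (\<Sum>a\<in>UNIV. S a a)"
    unfolding S_def by (subst sum.swap) (simp add: power2_norm_eq_inner inner_vec_def)
  then have "(\<Sum>k\<in>T. (norm (u k))\<^sup>2)\<^sup>2 \<le> (\<Sum>a\<in>UNIV. (S a a)\<^sup>2) * real CARD('d)"
    using sum_squared_le_sum_of_squares[of "\<lambda>a. S a a" "UNIV :: 'd set"] by simp
  also have "\<dots> \<le> (\<Sum>a\<in>UNIV. \<Sum>c\<in>UNIV. (S a c)\<^sup>2) * real CARD('d)"
  proof (intro mult_right_mono sum_mono)
    fix a :: 'd
    show "(S a a)\<^sup>2 \<le> (\<Sum>c\<in>UNIV. (S a c)\<^sup>2)"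
      by (rule member_le_sum) auto
  qed simp
  \<comment> \<open>Expand the squares and move the coordinate sums inside, where they factor into
    squared inner products.\<close>
  also have "(\<Sum>a\<in>UNIV. \<Sum>c\<in>UNIV. (S a c)\<^sup>2) =
      (\<Sum>a\<in>UNIV. \<Sum>c\<in>UNIV. \<Sum>j\<in>T. \<Sum>k\<in>T. (u j $ a * u k $ a) * (u j $ c * u k $ c))"
    by (simp add: S_def power2_eq_square sum_product mult_ac)
  also have "\<dots> = (\<Sum>a\<in>UNIV. \<Sum>j\<in>T. \<Sum>c\<in>UNIV. \<Sum>k\<in>T. (u j $ a * u k $ a) * (u j $ c * u k $ c))"
    by (intro sum.cong refl sum.swap)
  also have "\<dots> = (\<Sum>j\<in>T. \<Sum>a\<in>UNIV. \<Sum>k\<in>T. \<Sum>c\<in>UNIV. (u j $ a * u k $ a) * (u j $ c * u k $ c))"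
    by (subst sum.swap) (intro sum.cong refl sum.swap)
  also have "\<dots> = (\<Sum>j\<in>T. \<Sum>k\<in>T. \<Sum>a\<in>UNIV. \<Sum>c\<in>UNIV. (u j $ a * u k $ a) * (u j $ c * u k $ c))"
    by (intro sum.cong refl sum.swap)
  also have "\<dots> = (\<Sum>j\<in>T. \<Sum>k\<in>T. (u j \<bullet> u k)\<^sup>2)"
    by (simp add: inner_vec_def power2_eq_square sum_product)
  finally show ?thesis by (simp add: mult.commute)
qed

text \<open>In the Welch bound each row of the double sum is at most \<open>1 + (m - 1) * x\<close>.
  Dividing by \<open>m\<close> leaves a linear inequality, solvable for \<open>m\<close> because
  \<open>1 - d * x\<close> is positive.\<close>

lemma card_almost_orthogonal_le:
  fixes u :: "'i \<Rightarrow> real ^ 'd"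
  assumes "finite T" and unit: "\<And>k. k \<in> T \<Longrightarrow> norm (u k) = 1"
    and coh: "\<And>j k. j \<in> T \<Longrightarrow> k \<in> T \<Longrightarrow> j \<noteq> k \<Longrightarrow> (u j \<bullet> u k)\<^sup>2 \<le> x"
    and x: "x \<le> 1" "real CARD('d) * x < 1"
  shows "real (card T) \<le> real CARD('d) * ((1 - x) / (1 - real CARD('d) * x))"
proof (cases "T = {}")
  case True
  then show ?thesis using x by simp
next
  case False
  define d where "d = real CARD('d)"
  define m where "m = real (card T)"
  have m: "m \<ge> 1"
    using False \<open>finite T\<close> by (simp add: m_def Suc_le_eq card_gt_0_iff)
  have "m\<^sup>2 = (\<Sum>k\<in>T. (norm (u k))\<^sup>2)\<^sup>2"
    using unit by (simp add: m_def)
  also have "\<dots> \<le> d * (\<Sum>j\<in>T. \<Sum>k\<in>T. (u j \<bullet> u k)\<^sup>2)"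
    unfolding d_def by (rule Welch_bound)
  also have "\<dots> \<le> d * (\<Sum>j\<in>T. 1 + (m - 1) * x)"
  proof (intro mult_left_mono sum_mono)
    fix j assume j: "j \<in> T"
    have "(\<Sum>k\<in>T. (u j \<bullet> u k)\<^sup>2) = (u j \<bullet> u j)\<^sup>2 + (\<Sum>k\<in>T - {j}. (u j \<bullet> u k)\<^sup>2)"
      using \<open>finite T\<close> j by (rule sum.remove)
    also have "\<dots> \<le> 1 + (\<Sum>k\<in>T - {j}. x)"
      using unit[OF j] coh j by (intro add_mono sum_mono) (auto simp flip: power2_norm_eq_inner)
    also have "\<dots> = 1 + (m - 1) * x"
      using \<open>finite T\<close> j m by (simp add: m_def of_nat_diff)
    finally show "(\<Sum>k\<in>T. (u j \<bullet> u k)\<^sup>2) \<le> 1 + (m - 1) * x" .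
  qed (simp add: d_def)
  also have "\<dots> = m * (d * (1 + (m - 1) * x))"
    by (simp add: m_def)
  finally have "m \<le> d * (1 + (m - 1) * x)"
    using m by (simp add: power2_eq_square)
  then have "m * (1 - d * x) \<le> d * (1 - x)"
    by (simp add: algebra_simps)
  then show ?thesis
    using x by (simp add: d_def m_def field_simps)
qed

section \<open>Counting the vectors longer than \<open>sqrt c\<^sub>1\<close>\<close>

theorem theorem3:
  fixes b \<sigma> c\<^sub>1 c\<^sub>2 :: real and N :: nat
  assumes "1 < b"
    and "2 \<le> CARD('d::finite)" and "CARD('d) \<le> N"
    and "0 < c\<^sub>1" and "c\<^sub>1 < c\<^sub>2"
    and "0 \<le> \<sigma>" and "\<sigma> < c\<^sub>1 / sqrt (real CARD('d))"
  shows "\<exists>v :: nat \<Rightarrow> real ^ 'd. extremal b \<sigma> c\<^sub>1 c\<^sub>2 N v \<and>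
           real (card {i \<in> {1..N}. sqrt c\<^sub>1 < norm (v i)})
             \<le> real CARD('d) * ((c\<^sub>1\<^sup>2 - \<sigma>\<^sup>2) / (c\<^sub>1\<^sup>2 - real CARD('d) * \<sigma>\<^sup>2))"
proof -
  have "1 \<le> N" using assms(2,3) by simp
  obtain v :: "nat \<Rightarrow> real ^ 'd" where adm: "admissible c\<^sub>1 c\<^sub>2 N v" and ext: "extremal b \<sigma> c\<^sub>1 c\<^sub>2 N v"
    and min: "\<And>w :: nat \<Rightarrow> real ^ 'd. admissible c\<^sub>1 c\<^sub>2 N w \<Longrightarrow>
           (\<And>k. k \<in> {1..N} \<Longrightarrow> inv_sinr \<sigma> N w k \<le> inv_sinr \<sigma> N v k) \<Longrightarrow>
           (\<Sum>k\<in>{1..N}. (norm (v k))\<^sup>2) \<le> (\<Sum>k\<in>{1..N}. (norm (w k))\<^sup>2)"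
    using extremal_lexicographic[OF \<open>1 < b\<close> \<open>1 \<le> N\<close> \<open>0 < c\<^sub>1\<close> \<open>c\<^sub>1 < c\<^sub>2\<close>, where 'd = 'd] by metis
  define T where "T = {i \<in> {1..N}. sqrt c\<^sub>1 < norm (v i)}"
  have T: "c\<^sub>1 < (norm (v i))\<^sup>2" if "i \<in> T" for i
    using that real_less_rsqrt[of "norm (v i)" c\<^sub>1] real_sqrt_less_iff[of c\<^sub>1 "(norm (v i))\<^sup>2"]
    by (simp add: T_def)
  have pair: "(v i \<bullet> v j)\<^sup>2 \<le> \<sigma>\<^sup>2" if i: "i \<in> T" and j: "j \<in> T" and ij: "i \<noteq> j" for i j
  proof (rule ccontr)
    assume "\<not> (v i \<bullet> v j)\<^sup>2 \<le> \<sigma>\<^sup>2"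
    then have P: "\<sigma>\<^sup>2 < (v i \<bullet> v j)\<^sup>2" by simp
    then have P0: "0 < (v i \<bullet> v j)\<^sup>2"
      using zero_le_power2[of \<sigma>] by linarith
    have iN: "i \<in> {1..N}" and jN: "j \<in> {1..N}" using i j by (auto simp: T_def)
    \<comment> \<open>The least squared factor that keeps both vectors admissible and satisfies the
      condition for scaling a pair. All three entries are below \<open>1\<close>, so the shrinking
      is strict.\<close>
    define r where "r = max (\<sigma>\<^sup>2 / (v i \<bullet> v j)\<^sup>2) (max (c\<^sub>1 / (norm (v i))\<^sup>2) (c\<^sub>1 / (norm (v j))\<^sup>2))"
    define s where "s = sqrt r"
    have ti: "0 < (norm (v i))\<^sup>2" and tj: "0 < (norm (v j))\<^sup>2"
      using T[OF i] T[OF j] \<open>0 < c\<^sub>1\<close> by linarith+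
    have "0 < c\<^sub>1 / (norm (v i))\<^sup>2" using ti \<open>0 < c\<^sub>1\<close> by simp
    then have "0 < r" by (simp add: r_def less_max_iff_disj)
    moreover have "r < 1"
      using P P0 T[OF i] T[OF j] ti tj by (simp add: r_def)
    ultimately have s: "0 < s" "s < 1" and s2: "s\<^sup>2 = r" by (auto simp: s_def)
    have rP: "\<sigma>\<^sup>2 \<le> r * (v i \<bullet> v j)\<^sup>2" and ri: "c\<^sub>1 \<le> r * (norm (v i))\<^sup>2" and rj: "c\<^sub>1 \<le> r * (norm (v j))\<^sup>2"
      using P0 ti tj by (auto simp flip: pos_divide_le_eq simp: r_def)
    define a where "a = (\<lambda>l. if l = i \<or> l = j then s else 1)"
    have norm_le: "(norm (a l *\<^sub>R v l))\<^sup>2 \<le> (norm (v l))\<^sup>2" for l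
      using s by (auto simp: a_def intro!: power_mono mult_left_le_one_le)
    have "admissible c\<^sub>1 c\<^sub>2 N (\<lambda>l. a l *\<^sub>R v l)"
      unfolding admissible_def
    proof (intro ballI conjI)
      fix l assume "l \<in> {1..N}"
      then have l: "c\<^sub>1 \<le> (norm (v l))\<^sup>2" "(norm (v l))\<^sup>2 \<le> c\<^sub>2"
        using adm by (auto simp: admissible_def)
      show "(norm (a l *\<^sub>R v l))\<^sup>2 \<le> c\<^sub>2"
        using norm_le l(2) by (rule order_trans)
      show "c\<^sub>1 \<le> (norm (a l *\<^sub>R v l))\<^sup>2"
        using l(1) ri rj by (auto simp: a_def power_mult_distrib s2)
    qed
    moreover have "inv_sinr \<sigma> N (\<lambda>l. a l *\<^sub>R v l) k \<le> inv_sinr \<sigma> N v k" for k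
    proof -
      consider "k = i" | "k = j" | "k \<noteq> i" "k \<noteq> j" by blast
      then show ?thesis
      proof cases
        case 1
        then show ?thesis
          using inv_sinr_scale_pair[OF iN jN ij s, of \<sigma> v a] rP by (simp add: s2 a_def)
      next
        case 2
        then show ?thesis
          using inv_sinr_scale_pair[OF jN iN ij[symmetric] s, of \<sigma> v a] rP
          by (simp add: s2 a_def inner_commute)
      next
        case 3
        then show ?thesis
          using s by (intro inv_sinr_scale_others) (auto simp: a_def)
      qed
    qed
    ultimately have "(\<Sum>k\<in>{1..N}. (norm (v k))\<^sup>2) \<le> (\<Sum>k\<in>{1..N}. (norm (a k *\<^sub>R v k))\<^sup>2)"
      using min by blast
    \<comment> \<open>A strict decrease at the single index \<open>i\<close> already contradicts the
      minimal sum.\<close>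
    moreover have "(norm (a i *\<^sub>R v i))\<^sup>2 < (norm (v i))\<^sup>2"
      using \<open>r < 1\<close> ti by (simp add: a_def power_mult_distrib s2)
    then have "(\<Sum>k\<in>{1..N}. (norm (a k *\<^sub>R v k))\<^sup>2) < (\<Sum>k\<in>{1..N}. (norm (v k))\<^sup>2)"
      using iN norm_le by (intro sum_strict_mono_ex1) auto
    ultimately show False by simp
  qed
  \<comment> \<open>Normalising divides squared inner products of at most
    \<open>\<sigma>\<^sup>2\<close> by a product of squared norms that exceeds
    \<open>c\<^sub>1\<^sup>2\<close>.\<close>
  define x where "x = \<sigma>\<^sup>2 / c\<^sub>1\<^sup>2"
  \<comment> \<open>Squaring the assumed bound on \<open>\<sigma>\<close> yields the condition
    \<open>d * x < 1\<close> of the counting lemma.\<close>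
  have "\<sigma> * sqrt (real CARD('d)) < c\<^sub>1"
    using assms(7) by (simp add: pos_less_divide_eq)
  then have "(\<sigma> * sqrt (real CARD('d)))\<^sup>2 < c\<^sub>1\<^sup>2"
    using \<open>0 \<le> \<sigma>\<close> by (intro power_strict_mono) auto
  then have d\<sigma>: "real CARD('d) * \<sigma>\<^sup>2 < c\<^sub>1\<^sup>2"
    by (simp add: power_mult_distrib mult.commute)
  then have dx: "real CARD('d) * x < 1"
    using \<open>0 < c\<^sub>1\<close> by (simp add: x_def)
  have "1 * x \<le> real CARD('d) * x"
    using assms(2) by (intro mult_right_mono) (auto simp: x_def)
  then have "x \<le> 1" using dx by simp
  have "real (card T) \<le> real CARD('d) * ((1 - x) / (1 - real CARD('d) * x))"
  proof (rule card_almost_orthogonal_le[where u = "\<lambda>k. v k /\<^sub>R norm (v k)"])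
    show "finite T" by (simp add: T_def)
    show "norm (v k /\<^sub>R norm (v k)) = 1" if "k \<in> T" for k
    proof -
      have "v k \<noteq> 0" using T[OF that] \<open>0 < c\<^sub>1\<close> by auto
      then show ?thesis by simp
    qed
    fix i j assume ij: "i \<in> T" "j \<in> T" "i \<noteq> j"
    have "((v i /\<^sub>R norm (v i)) \<bullet> (v j /\<^sub>R norm (v j)))\<^sup>2 =
        (v i \<bullet> v j)\<^sup>2 / ((norm (v i))\<^sup>2 * (norm (v j))\<^sup>2)"
      by (simp add: power_mult_distrib field_simps)
    also have "\<dots> \<le> \<sigma>\<^sup>2 / (c\<^sub>1 * c\<^sub>1)"
      using pair[OF ij] T[OF ij(1)] T[OF ij(2)] \<open>0 < c\<^sub>1\<close>
      by (intro frac_le mult_mono) auto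
    finally show "((v i /\<^sub>R norm (v i)) \<bullet> (v j /\<^sub>R norm (v j)))\<^sup>2 \<le> x"
      by (simp add: x_def power2_eq_square)
  qed (use dx \<open>x \<le> 1\<close> in auto)
  also have "(1 - x) / (1 - real CARD('d) * x) = (c\<^sub>1\<^sup>2 - \<sigma>\<^sup>2) / (c\<^sub>1\<^sup>2 - real CARD('d) * \<sigma>\<^sup>2)"
  proof -
    have "1 - x = (c\<^sub>1\<^sup>2 - \<sigma>\<^sup>2) / c\<^sub>1\<^sup>2"
      and "1 - real CARD('d) * x = (c\<^sub>1\<^sup>2 - real CARD('d) * \<sigma>\<^sup>2) / c\<^sub>1\<^sup>2"
      using \<open>0 < c\<^sub>1\<close> by (simp_all add: x_def diff_divide_distrib)
    then show ?thesis
      using \<open>0 < c\<^sub>1\<close> by simp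
  qed
  finally show ?thesis
    using ext unfolding T_def by blast
qed

end
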